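(* Let $T=2$ and $N\in\mathbb{N}$ (with $N\ge 1$). Suppose $\tilde\mu\in(-N^2,1)$. Then there exist real numbers $a_1,\ldots,a_N$ satisfying $a_1+\cdots+a_N=1$ such that, for every $\mu\in(\tilde\mu,1)$, all the roots of the polynomial $p(\lambda)=\lambda^{(N-1)T+1}-\mu\,(q(\lambda))^T$, where $q(\lambda)=a_1\lambda^{N-1}+\cdots+a_{N-1}\lambda+a_N$, lie in the unit disc $\{z\in\mathbb{C}:|z|<1\}$.
   Context: For $T,N\in\mathbb{N}$, real $a_1,\ldots,a_N$ with $a_1+\cdots+a_N=1$, and real $\mu$, define $q(\lambda)=a_1\lambda^{N-1}+\cdots+a_{N-1}\lambda+a_N$ and $p(\lambda)=\lambda^{(N-1)T+1}-\mu\,(q(\lambda))^T$. Here $T=2$, so $p(\lambda)=\lambda^{2N-1}-\mu\,(q(\lambda))^2$. The numbers $a_1,\dots,a_N$ depend only on $\tilde\mu$ and $N$, not on $\mu$. *)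

theory Defs
  imports "HOL-Analysis.Analysis" "HOL-Computational_Algebra.Polynomial"
begin

(* The coefficients a_1, ..., a_N are the values of a function a at the indices 1, ..., N;
   its values elsewhere play no role. *)
definition q_poly :: "nat \<Rightarrow> (nat \<Rightarrow> real) \<Rightarrow> real poly" where
  "q_poly N a = (\<Sum>j = 1..N. monom (a j) (N - j))"

definition p_poly :: "nat \<Rightarrow> nat \<Rightarrow> (nat \<Rightarrow> real) \<Rightarrow> real \<Rightarrow> real poly" where
  "p_poly T N a \<mu> = monom 1 ((N - 1) * T + 1) - smult \<mu> (q_poly N a ^ T)"

end

theory Submission
  imports Defs "HOL-Complex_Analysis.Conformal_Mappings"
begin

text \<open>
  Put \<open>A z = a 1 + a 2 * z + \<dots> + a N * z ^ (N - 1)\<close> and let \<open>G w = w * A (w\<^sup>2)\<close>, an odd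
  polynomial with \<open>G 1 = 1\<close>.  If \<open>z\<close> is a root of \<open>p\<close> with \<open>norm z \<ge> 1\<close>, then the square root
  \<open>w\<close> of \<open>1 / z\<close> with \<open>Re w \<ge> 0\<close> lies in the closed unit disc and \<open>\<mu> * (G w)\<^sup>2 = 1\<close>.  So it
  suffices to exclude this equation on the closed right half of the unit disc.  For \<open>\<mu> \<ge> 0\<close> it
  is excluded by \<open>norm (G w) \<le> 1\<close>, which holds whenever the \<open>a j\<close> are nonnegative with sum \<open>1\<close>.
  For \<open>\<mu> < 0\<close> the value \<open>G w\<close> is imaginary, and one has to know how large the imaginary
  values of \<open>G\<close> can be.

  The extremal choice is the Fejer type polynomial with \<open>a j = (2 * N - 2 * j + 1) / N\<^sup>2\<close>,
  whose real part on the unit circle is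
  \<open>cos t * (sin (N * t) / (N * sin t))\<^sup>2\<close>.  Hence \<open>Re (G w) \<ge> 0\<close> on the boundary of the half
  disc (on the imaginary axis \<open>G\<close> is imaginary, being odd and real), and by the maximum principle
  \<open>Re (G w) \<ge> 0\<close> on the whole half disc (lemma \<open>Re_odd_fejer_nonneg\<close>).  On the imaginary axis
  \<open>norm (G w) \<le> 1 / N\<close> (lemma \<open>norm_odd_fejer_imaginary_axis\<close>).  Both lemmas speak of
  \<open>w * fejer_sum N (w\<^sup>2) = N\<^sup>2 * G w\<close>.

  For \<open>N \<ge> 3\<close> this real part has zeros on the circle away from the imaginary axis, where \<open>G\<close>
  takes imaginary values not covered by the last bound.  These zeros disappear when
  \<open>G\<close> is replaced by \<open>(1 - \<epsilon>) * G w + \<epsilon> * w\<close>, whose real part is at least \<open>\<epsilon> * Re w\<close>: now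
  imaginary values occur only on the imaginary axis, and they are bounded by
  \<open>(1 - \<epsilon>) / N + \<epsilon>\<close>.  As \<open>\<mu>' > - N\<^sup>2\<close>, a small \<open>\<epsilon>\<close> makes this bound smaller than
  \<open>1 / sqrt (- \<mu>')\<close> in the only case that matters, \<open>\<mu>' < 0\<close>.
\<close>

section \<open>The Fejer type sum\<close>

definition fejer_sum :: "nat \<Rightarrow> 'a::comm_ring_1 \<Rightarrow> 'a" where
  "fejer_sum N z = (\<Sum>i<N. (2 * of_nat N - 1 - 2 * of_nat i) * z ^ i)"

lemma fejer_sum_Suc:
  "fejer_sum (Suc N) z = fejer_sum N z + 2 * (\<Sum>i<N. z ^ i) + z ^ N"
  by (simp add: fejer_sum_def sum_distrib_left flip: sum.distrib)
     (intro sum.cong refl, simp add: algebra_simps)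

lemma fejer_sum_closed_form:
  fixes z :: "'a::comm_ring_1"
  shows "(1 - z)\<^sup>2 * fejer_sum N z
       = (2 * of_nat N - 1) - (2 * of_nat N + 1) * z + z ^ N * (1 + z)"
proof (induction N)
  case 0
  show ?case by (simp add: fejer_sum_def)
next
  case (Suc N)
  have geom: "(1 - z) * (\<Sum>i<N. z ^ i) = 1 - z ^ N"
    by (rule one_diff_power_eq [symmetric])
  have "(1 - z)\<^sup>2 * fejer_sum (Suc N) z
      = (1 - z)\<^sup>2 * fejer_sum N z + 2 * (1 - z) * ((1 - z) * (\<Sum>i<N. z ^ i)) + (1 - z)\<^sup>2 * z ^ N"
    by (simp add: fejer_sum_Suc algebra_simps power2_eq_square)
  also have "\<dots> = (2 * of_nat (Suc N) - 1) - (2 * of_nat (Suc N) + 1) * z + z ^ Suc N * (1 + z)"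
    unfolding Suc.IH geom by (simp add: algebra_simps power2_eq_square)
  finally show ?case .
qed

lemma fejer_sum_one: "fejer_sum N (1::'a::comm_ring_1) = (of_nat N)\<^sup>2"
  by (induction N) (simp_all add: fejer_sum_Suc, simp_all add: fejer_sum_def power2_eq_square algebra_simps)

lemma fejer_sum_of_real: "fejer_sum N (of_real x :: complex) = of_real (fejer_sum N x)"
  by (simp add: fejer_sum_def)

lemma norm_fejer_sum_le:
  fixes z :: complex
  assumes "norm z \<le> 1"
  shows "norm (fejer_sum N z) \<le> (real N)\<^sup>2"
proof -
  have "norm (fejer_sum N z) \<le> (\<Sum>i<N. norm ((2 * of_nat N - 1 - 2 * of_nat i) * z ^ i))"
    unfolding fejer_sum_def by (rule norm_sum)
  also have "\<dots> \<le> (\<Sum>i<N. (2 * real N - 1 - 2 * real i) * 1 ^ i)"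
  proof (rule sum_mono)
    fix i assume "i \<in> {..<N}"
    then have pos: "2 * real N - 1 - 2 * real i \<ge> 0" by auto
    have "(2 * of_nat N - 1 - 2 * of_nat i :: complex) = of_real (2 * real N - 1 - 2 * real i)"
      by simp
    then have "norm (2 * of_nat N - 1 - 2 * of_nat i :: complex) = 2 * real N - 1 - 2 * real i"
      using pos by (metis norm_of_real abs_of_nonneg)
    moreover have "norm (z ^ i) \<le> 1"
      using assms by (simp add: norm_power power_le_one)
    ultimately show "norm ((2 * of_nat N - 1 - 2 * of_nat i) * z ^ i)
        \<le> (2 * real N - 1 - 2 * real i) * 1 ^ i"
      using pos by (simp add: norm_mult mult_left_le)
  qed
  also have "\<dots> = (real N)\<^sup>2"
    using fejer_sum_one [of N, where 'a = real] by (simp add: fejer_sum_def)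
  finally show ?thesis .
qed

section \<open>Real part on the half disc\<close>

text \<open>
  With \<open>w = exp (\<i> * t)\<close> this is the identity
  \<open>Re (w * fejer_sum N (w\<^sup>2)) = cos t * (sin (N * t) / sin t)\<^sup>2\<close>, cleared of denominators.  It is
  the real part of the closed form multiplied by \<open>cnj w\<close>, because
  \<open>(1 - w\<^sup>2)\<^sup>2 = - 4 * (sin t)\<^sup>2 * w\<^sup>2\<close> on the circle.
\<close>

lemma Re_odd_fejer_circle:
  fixes w :: complex
  assumes "norm w = 1"
  shows "2 * (Im w)\<^sup>2 * Re (w * fejer_sum N (w\<^sup>2)) = Re w * (1 - Re ((w\<^sup>2) ^ N))"
proof -
  let ?z = "w\<^sup>2" and ?F = "fejer_sum N (w\<^sup>2)"
  have inv: "cnj w * w = 1"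
    using assms by (metis complex_norm_square mult.commute of_real_1 one_power2)
  have "cnj w * (1 - ?z) = cnj w - (cnj w * w) * w"
    by (simp add: right_diff_distrib power2_eq_square mult.assoc)
  also have "\<dots> = - (2 * \<i> * of_real (Im w))"
    unfolding inv by (simp add: complex_eq_iff)
  finally have d: "cnj w * (1 - ?z) = - (2 * \<i> * of_real (Im w))" .
  have "of_real (- 4 * (Im w)\<^sup>2) * (w * ?F) = (cnj w * (1 - ?z))\<^sup>2 * (w * ?F)"
    unfolding d by (simp add: power_mult_distrib)
  also have "\<dots> = (cnj w * w) * (cnj w * ((1 - ?z)\<^sup>2 * ?F))"
    by (simp add: power2_eq_square mult_ac)
  also have "\<dots> = cnj w * ((2 * of_nat N - 1) - (2 * of_nat N + 1) * ?z + ?z ^ N * (1 + ?z))"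
    by (simp add: inv fejer_sum_closed_form)
  also have "\<dots> = (2 * of_nat N - 1) * cnj w - (2 * of_nat N + 1) * (cnj w * w * w)
                  + ?z ^ N * (cnj w + cnj w * w * w)"
    by (simp add: algebra_simps power2_eq_square)
  also have "\<dots> = (2 * of_nat N - 1) * cnj w - (2 * of_nat N + 1) * w
                  + ?z ^ N * of_real (2 * Re w)"
    by (simp add: inv complex_add_cnj add.commute)
  finally have "Re (of_real (- 4 * (Im w)\<^sup>2) * (w * ?F))
      = Re ((2 * of_nat N - 1) * cnj w - (2 * of_nat N + 1) * w + ?z ^ N * of_real (2 * Re w))"
    by simp
  then show ?thesis
    by (simp add: algebra_simps)
qed

text \<open>
  The maximum principle for the harmonic function \<open>Re G\<close> on the half disc, with \<open>G\<close> the negated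
  polynomial.  The boundary consists of a piece of the imaginary axis, where \<open>w\<^sup>2\<close> is real and
  so \<open>Re G = 0\<close>, and of a half circle, where the preceding identity gives the sign.
\<close>

lemma Re_odd_fejer_nonneg:
  fixes w :: complex
  assumes "Re w \<ge> 0" and "norm w \<le> 1"
  shows "Re (w * fejer_sum N (w\<^sup>2)) \<ge> 0"
proof -
  define G where "G = (\<lambda>w::complex. - (w * fejer_sum N (w\<^sup>2)))"
  define S where "S = {w::complex. Re w \<ge> 0} \<inter> cball 0 1"
  have holo: "G holomorphic_on A" for A
    unfolding G_def fejer_sum_def by (intro holomorphic_intros)
  have closed: "closed S"
    unfolding S_def by (intro closed_Int closed_halfspace_Re_ge closed_cball)
  have boundary: "Re (G v) \<le> 0" if v: "v \<in> frontier S" for v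
  proof -
    have vS: "v \<in> S"
      using v closed frontier_subset_eq by blast
    have "open ({w::complex. Re w > 0} \<inter> ball 0 1)"
      by (intro open_Int open_halfspace_Re_gt open_ball)
    then have "{w::complex. Re w > 0} \<inter> ball 0 1 \<subseteq> interior S"
      by (intro interior_maximal) (auto simp: S_def)
    then have "v \<notin> {w. Re w > 0} \<inter> ball 0 1"
      using v by (auto simp: frontier_def)
    then consider "Re v = 0" | "norm v = 1"
      using vS by (fastforce simp: S_def)
    then show ?thesis
    proof cases
      case 1
      then have "v\<^sup>2 = of_real (- (Im v)\<^sup>2)"
        by (simp add: complex_eq_iff power2_eq_square)
      then show ?thesis
        using 1 by (simp add: G_def fejer_sum_of_real del: of_real_minus of_real_power)
    next
      case 2
      have "Re ((v\<^sup>2) ^ N) \<le> 1"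
        using complex_Re_le_cmod [of "(v\<^sup>2) ^ N"] 2 by (simp add: norm_power)
      then have "Re v * (1 - Re ((v\<^sup>2) ^ N)) \<ge> 0"
        using vS by (intro mult_nonneg_nonneg) (auto simp: S_def)
      then have *: "(Im v)\<^sup>2 * Re (v * fejer_sum N (v\<^sup>2)) \<ge> 0"
        using Re_odd_fejer_circle [OF 2, of N] by linarith
      \<comment> \<open>The identity is void at the real point of the half circle.\<close>
      show ?thesis
      proof (cases "Im v = 0")
        case True
        then have "v = 1"
          using 2 vS by (auto simp: S_def complex_eq_iff cmod_eq_Re)
        then show ?thesis
          by (simp add: G_def fejer_sum_one flip: of_nat_power)
      next
        case False
        then have "(Im v)\<^sup>2 > 0" by simp
        then show ?thesis
          using * by (simp add: G_def zero_le_mult_iff del: times_complex.sel)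
      qed
    qed
  qed
  have "Re (G w) \<le> 0"
  proof (rule maximum_real_frontier [of G S _ w])
    show "G holomorphic_on interior S" by (rule holo)
    show "continuous_on (closure S) G" by (rule holomorphic_on_imp_continuous_on [OF holo])
    show "bounded S" unfolding S_def by (simp add: bounded_Int)
    show "w \<in> S" using assms by (simp add: S_def)
  qed (rule boundary)
  then show ?thesis
    by (simp add: G_def)
qed

section \<open>Size on the imaginary axis\<close>

text \<open>
  By the closed form at \<open>- u\<^sup>2\<close>, \<open>(1 + u\<^sup>2)\<^sup>2 * (N - u * fejer_sum N (- u\<^sup>2))\<close> is
  \<open>N * (1 + u\<^sup>2) * (1 - u)\<^sup>2 + u * (1 - u\<^sup>2) * (1 - (- u\<^sup>2) ^ N)\<close>, in which every factor is
  nonnegative.  Equality holds at \<open>u = 1\<close>, which is where the number \<open>N\<^sup>2\<close> in the range of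
  \<open>\<mu>'\<close> comes from.
\<close>

lemma odd_fejer_real_bound:
  fixes u :: real
  assumes "0 \<le> u" and "u \<le> 1"
  shows "\<bar>u * fejer_sum N (- u\<^sup>2)\<bar> \<le> real N"
proof (cases "N = 0")
  case True
  then show ?thesis by (simp add: fejer_sum_def)
next
  case False
  let ?x = "u\<^sup>2" and ?F = "fejer_sum N (- u\<^sup>2)"
  have x: "0 \<le> ?x" "?x \<le> 1"
    using assms by (auto simp: power_le_one)
  have pow: "\<bar>(- ?x) ^ N\<bar> \<le> 1"
    using x by (simp add: power_abs power_le_one)
  have closed: "(1 + ?x)\<^sup>2 * ?F = (2 * real N - 1) + (2 * real N + 1) * ?x + (- ?x) ^ N * (1 - ?x)"
    using fejer_sum_closed_form [of "- ?x" N] by simp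
  have "\<bar>(- ?x) ^ N * (1 - ?x)\<bar> \<le> 1"
    unfolding abs_mult using pow x by (intro mult_le_one) auto
  then have "(- ?x) ^ N * (1 - ?x) \<ge> - 1"
    by (simp only: abs_le_iff minus_le_iff)
  moreover have "(2 * real N + 1) * ?x \<ge> 0"
    using x by simp
  moreover have "2 * real N - 1 \<ge> 1"
    using False by simp
  moreover have "0 \<le> a + b + c" if "c \<ge> - 1" "b \<ge> 0" "a \<ge> 1" for a b c :: real
    using that by linarith
  ultimately have "(1 + ?x)\<^sup>2 * ?F \<ge> 0"
    unfolding closed by blast
  moreover have "(1 + ?x)\<^sup>2 > 0"
    using x by (intro zero_less_power) linarith
  ultimately have lower: "u * ?F \<ge> 0"
    using assms by (simp add: zero_le_mult_iff)
  have "(1 + ?x)\<^sup>2 * (N - u * ?F)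
      = N * (1 + ?x)\<^sup>2 - u * ((2 * real N - 1) + (2 * real N + 1) * ?x + (- ?x) ^ N * (1 - ?x))"
    unfolding closed [symmetric] by (simp add: algebra_simps)
  also have "\<dots> = N * ((1 + ?x) * (1 - u)\<^sup>2) + u * ((1 - ?x) * (1 - (- ?x) ^ N))"
    by (simp add: algebra_simps power2_eq_square)
  also have "\<dots> \<ge> 0"
    using assms x abs_le_D1 [OF pow] by (intro add_nonneg_nonneg mult_nonneg_nonneg) simp_all
  finally have "N - u * ?F \<ge> 0"
    using \<open>(1 + ?x)\<^sup>2 > 0\<close> by (simp add: zero_le_mult_iff)
  with lower show ?thesis by simp
qed

lemma norm_odd_fejer_imaginary_axis:
  fixes w :: complex
  assumes "Re w = 0" and "norm w \<le> 1"
  shows "norm (w * fejer_sum N (w\<^sup>2)) \<le> real N"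
proof -
  have "w\<^sup>2 = of_real (- \<bar>Im w\<bar>\<^sup>2)"
    using assms by (simp add: complex_eq_iff power2_eq_square)
  moreover have "norm w = \<bar>Im w\<bar>"
    using assms by (simp add: cmod_eq_Im)
  ultimately have "norm (w * fejer_sum N (w\<^sup>2)) = \<bar>\<bar>Im w\<bar> * fejer_sum N (- \<bar>Im w\<bar>\<^sup>2)\<bar>"
    by (simp add: norm_mult abs_mult fejer_sum_of_real del: of_real_minus of_real_power power2_abs)
  also have "\<dots> \<le> real N"
    using assms \<open>norm w = \<bar>Im w\<bar>\<close> by (intro odd_fejer_real_bound) auto
  finally show ?thesis .
qed

section \<open>The perturbed polynomial\<close>

text \<open>
  The coefficients of \<open>(1 - \<epsilon>) * G w + \<epsilon> * w\<close> for the extremal \<open>G\<close>, counted from \<open>1\<close>: the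
  term with index \<open>j\<close> belongs to \<open>w ^ (2 * j - 1)\<close>, so the damping \<open>\<epsilon> * w\<close> affects only
  \<open>j = 1\<close>.
\<close>

definition damped_coeff :: "nat \<Rightarrow> real \<Rightarrow> nat \<Rightarrow> real" where
  "damped_coeff N \<epsilon> j =
     (1 - \<epsilon>) / (real N)\<^sup>2 * (2 * real N - 2 * real j + 1) + (if j = 1 then \<epsilon> else 0)"

definition damped_odd :: "nat \<Rightarrow> real \<Rightarrow> complex \<Rightarrow> complex" where
  "damped_odd N \<epsilon> w = of_real ((1 - \<epsilon>) / (real N)\<^sup>2) * (w * fejer_sum N (w\<^sup>2)) + of_real \<epsilon> * w"

lemma sum_damped_coeff_powers:
  fixes z :: "'a::real_algebra_1"
  assumes "N \<ge> 1"
  shows "(\<Sum>j = 1..N. of_real (damped_coeff N \<epsilon> j) * z ^ (j - 1))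
       = of_real ((1 - \<epsilon>) / (real N)\<^sup>2) *
           (\<Sum>i<N. of_real (2 * real N - 1 - 2 * real i) * z ^ i) + of_real \<epsilon>"
proof -
  have "(\<Sum>j = 1..N. of_real (damped_coeff N \<epsilon> j) * z ^ (j - 1))
      = (\<Sum>i<N. of_real (damped_coeff N \<epsilon> (Suc i)) * z ^ i)"
    by (rule sum.reindex_bij_witness [of _ Suc "\<lambda>j. j - 1"]) auto
  also have "\<dots> = (\<Sum>i<N. of_real ((1 - \<epsilon>) / (real N)\<^sup>2) *
      (of_real (2 * real N - 1 - 2 * real i) * z ^ i) + (if i = 0 then of_real \<epsilon> else 0))"
  proof (rule sum.cong)
    fix i
    have "2 * real N - 2 * real (Suc i) + 1 = 2 * real N - 1 - 2 * real i"
      by simp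
    then show "of_real (damped_coeff N \<epsilon> (Suc i)) * z ^ i = of_real ((1 - \<epsilon>) / (real N)\<^sup>2) *
      (of_real (2 * real N - 1 - 2 * real i) * z ^ i) + (if i = 0 then of_real \<epsilon> else 0)"
      unfolding damped_coeff_def
      by (simp only: of_real_add of_real_mult distrib_right mult.assoc) simp
  qed simp
  also have "\<dots> = of_real ((1 - \<epsilon>) / (real N)\<^sup>2) *
      (\<Sum>i<N. of_real (2 * real N - 1 - 2 * real i) * z ^ i) + of_real \<epsilon>"
    using assms by (simp add: sum.distrib sum_distrib_left)
  finally show ?thesis .
qed

lemma sum_damped_coeff:
  assumes "N \<ge> 1"
  shows "(\<Sum>j = 1..N. damped_coeff N \<epsilon> j) = 1"
  using sum_damped_coeff_powers [OF assms, where z = "1::real" and \<epsilon> = \<epsilon>]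
    fejer_sum_one [of N, where 'a = real] assms
  by (simp add: fejer_sum_def)

lemma damped_odd_eq_sum:
  assumes "N \<ge> 1"
  shows "damped_odd N \<epsilon> w = w * (\<Sum>j = 1..N. of_real (damped_coeff N \<epsilon> j) * (w\<^sup>2) ^ (j - 1))"
  unfolding sum_damped_coeff_powers [OF assms] damped_odd_def fejer_sum_def
  by (simp add: algebra_simps)

lemma norm_damped_odd_le:
  assumes "0 \<le> \<epsilon>" "\<epsilon> \<le> 1" and "norm (w * fejer_sum N (w\<^sup>2)) \<le> c" and "norm w \<le> 1"
  shows "norm (damped_odd N \<epsilon> w) \<le> (1 - \<epsilon>) / (real N)\<^sup>2 * c + \<epsilon>"
proof -
  let ?k = "(1 - \<epsilon>) / (real N)\<^sup>2"
  have "norm (damped_odd N \<epsilon> w)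
      \<le> norm (of_real ?k * (w * fejer_sum N (w\<^sup>2))) + norm (of_real \<epsilon> * w)"
    unfolding damped_odd_def by (rule norm_triangle_ineq)
  also have "\<dots> = ?k * norm (w * fejer_sum N (w\<^sup>2)) + \<epsilon> * norm w"
    using assms by (simp only: norm_mult norm_of_real) simp
  also have "\<dots> \<le> ?k * c + \<epsilon> * 1"
    using assms by (intro add_mono mult_left_mono) auto
  finally show ?thesis by simp
qed

text \<open>
  The lower bound on \<open>\<mu>\<close> enters only through the imaginary axis: anywhere else in the half
  disc the perturbation makes the real part positive, so that \<open>(damped_odd N \<epsilon> w)\<^sup>2\<close> is not a
  negative real.
\<close>

lemma damped_odd_excludes:
  fixes w :: complex
  assumes N: "N \<ge> 1" and \<epsilon>: "0 < \<epsilon>" "\<epsilon> \<le> 1"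
    and small: "- \<mu> * ((1 - \<epsilon>) / real N + \<epsilon>)\<^sup>2 < 1" and "\<mu> < 1"
    and w: "Re w \<ge> 0" "norm w \<le> 1"
  shows "of_real \<mu> * (damped_odd N \<epsilon> w)\<^sup>2 \<noteq> 1"
proof
  let ?G = "damped_odd N \<epsilon> w"
  assume eq: "of_real \<mu> * ?G\<^sup>2 = 1"
  then have norm_eq: "\<bar>\<mu>\<bar> * (norm ?G)\<^sup>2 = 1"
    by (metis norm_mult norm_of_real norm_one norm_power)
  show False
  proof (cases "\<mu> \<ge> 0")
    case True
    have "norm w * norm (fejer_sum N (w\<^sup>2)) \<le> 1 * (real N)\<^sup>2"
      using w by (intro mult_mono norm_fejer_sum_le) (auto simp: norm_power power_le_one)
    then have "norm ?G \<le> (1 - \<epsilon>) / (real N)\<^sup>2 * (real N)\<^sup>2 + \<epsilon>"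
      using \<epsilon> w by (intro norm_damped_odd_le) (auto simp: norm_mult)
    then have "(norm ?G)\<^sup>2 \<le> 1"
      using N by (simp add: power_le_one)
    then have "\<bar>\<mu>\<bar> * (norm ?G)\<^sup>2 \<le> \<bar>\<mu>\<bar>"
      by (simp add: mult_left_le)
    then show False
      using norm_eq True \<open>\<mu> < 1\<close> by simp
  next
    case False
    \<comment> \<open>A complex number with a negative real square is imaginary.\<close>
    have "?G\<^sup>2 = of_real (1 / \<mu>)"
      using eq False by (simp add: field_simps)
    then have "Im (?G\<^sup>2) = 0" "Re (?G\<^sup>2) < 0"
      using False by (simp_all del: of_real_divide)
    then have "Re ?G = 0"
      by (auto simp: power2_eq_square)
    moreover have "Re ?G = (1 - \<epsilon>) / (real N)\<^sup>2 * Re (w * fejer_sum N (w\<^sup>2)) + \<epsilon> * Re w"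
      unfolding damped_odd_def by simp
    moreover have "(1 - \<epsilon>) / (real N)\<^sup>2 * Re (w * fejer_sum N (w\<^sup>2)) \<ge> 0"
      using \<epsilon> Re_odd_fejer_nonneg [OF w] by (intro mult_nonneg_nonneg) auto
    ultimately have "\<epsilon> * Re w \<le> 0"
      by linarith
    then have "Re w = 0"
      using \<epsilon> w by (simp add: mult_le_0_iff)
    then have "norm ?G \<le> (1 - \<epsilon>) / (real N)\<^sup>2 * real N + \<epsilon>"
      using \<epsilon> w by (intro norm_damped_odd_le norm_odd_fejer_imaginary_axis) auto
    also have "\<dots> = (1 - \<epsilon>) / real N + \<epsilon>"
      using N by (simp add: power2_eq_square)
    finally have "(norm ?G)\<^sup>2 \<le> ((1 - \<epsilon>) / real N + \<epsilon>)\<^sup>2"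
      by (intro power_mono) auto
    then have "- \<mu> * (norm ?G)\<^sup>2 \<le> - \<mu> * ((1 - \<epsilon>) / real N + \<epsilon>)\<^sup>2"
      using False by (intro mult_left_mono) auto
    then have "- \<mu> * (norm ?G)\<^sup>2 < 1"
      using small by (rule le_less_trans)
    then show False
      using norm_eq False by simp
  qed
qed

lemma exists_damping:
  fixes N :: nat and \<mu> :: real
  assumes "N \<ge> 1" and "\<mu> > - (real N)\<^sup>2"
  shows "\<exists>\<epsilon>>0. \<epsilon> \<le> 1 \<and> - \<mu> * ((1 - \<epsilon>) / real N + \<epsilon>)\<^sup>2 < 1"
proof -
  have "((\<lambda>\<epsilon>. - \<mu> * ((1 - \<epsilon>) / real N + \<epsilon>)\<^sup>2) \<longlongrightarrow> - \<mu> * ((1 - 0) / real N + 0)\<^sup>2) (at_right 0)"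
    using assms by (intro tendsto_intros) simp_all
  moreover have "- \<mu> * ((1 - 0) / real N + 0)\<^sup>2 < 1"
    using assms by (simp add: power_divide pos_less_divide_eq)
  ultimately have "\<forall>\<^sub>F \<epsilon> in at_right 0. - \<mu> * ((1 - \<epsilon>) / real N + \<epsilon>)\<^sup>2 < 1"
    by (rule order_tendstoD)
  moreover have "\<forall>\<^sub>F \<epsilon> in at_right 0. \<epsilon> \<in> {0<..<1::real}"
    by (rule eventually_at_right_real) simp
  ultimately have "\<forall>\<^sub>F \<epsilon> in at_right 0.
      - \<mu> * ((1 - \<epsilon>) / real N + \<epsilon>)\<^sup>2 < 1 \<and> \<epsilon> \<in> {0<..<1::real}"
    by (rule eventually_conj)
  then obtain \<epsilon> where "- \<mu> * ((1 - \<epsilon>) / real N + \<epsilon>)\<^sup>2 < 1 \<and> \<epsilon> \<in> {0<..<1::real}"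
    using eventually_happens' [OF trivial_limit_at_right_real] by blast
  then show ?thesis
    by (intro exI [of _ \<epsilon>]) auto
qed

section \<open>From roots to the half disc\<close>

lemma poly_of_real_hom:
  fixes p q :: "real poly" and z :: complex
  shows "poly (map_poly of_real (p + q)) z
           = poly (map_poly of_real p) z + poly (map_poly of_real q) z"
    and "poly (map_poly of_real (p - q)) z
           = poly (map_poly of_real p) z - poly (map_poly of_real q) z"
    and "poly (map_poly of_real (smult c p)) z = of_real c * poly (map_poly of_real p) z"
proof -
  have "map_poly of_real (p + q) = (map_poly of_real p + map_poly of_real q :: complex poly)"
    and "map_poly of_real (p - q) = (map_poly of_real p - map_poly of_real q :: complex poly)"
    and "map_poly of_real (smult c p) = (smult (of_real c) (map_poly of_real p) :: complex poly)"
    by (auto simp: poly_eq_iff coeff_map_poly)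
  then show "poly (map_poly of_real (p + q)) z
           = poly (map_poly of_real p) z + poly (map_poly of_real q) z"
    and "poly (map_poly of_real (p - q)) z
           = poly (map_poly of_real p) z - poly (map_poly of_real q) z"
    and "poly (map_poly of_real (smult c p)) z = of_real c * poly (map_poly of_real p) z"
    by simp_all
qed

lemma poly_of_real_mult:
  fixes p q :: "real poly" and z :: complex
  shows "poly (map_poly of_real (p * q)) z
           = poly (map_poly of_real p) z * poly (map_poly of_real q) z"
  by (induction p) (simp_all add: poly_of_real_hom map_poly_pCons algebra_simps)

lemma poly_of_real_p_poly_2:
  fixes z :: complex
  shows "poly (map_poly of_real (p_poly 2 N a \<mu>)) z
       = z ^ ((N - 1) * 2 + 1) - of_real \<mu> * (\<Sum>j = 1..N. of_real (a j) * z ^ (N - j))\<^sup>2"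
proof -
  have "poly (map_poly of_real (\<Sum>j\<in>J. monom (a j) (N - j))) z
      = (\<Sum>j\<in>J. of_real (a j) * z ^ (N - j))" if "finite J" for J
    using that
    by (induction J) (simp_all add: poly_of_real_hom map_poly_monom poly_monom)
  then show ?thesis
    by (simp add: p_poly_def q_poly_def poly_of_real_hom poly_of_real_mult map_poly_monom
        poly_monom power2_eq_square)
qed

text \<open>
  Substituting \<open>z = 1 / w\<^sup>2\<close> and dividing by \<open>z ^ (2 * N - 2)\<close> reverses the order of the
  coefficients and leaves a single factor \<open>z\<close> on one side.  Because \<open>z\<close> is the inverse of a
  square, it can be moved under the square of the sum; here the exponent \<open>2\<close> matters.  Of the two
  square roots of \<open>1 / z\<close>, the principal one has nonnegative real part.
\<close>

lemma root_p_poly_2_half_disc: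
  fixes z :: complex
  assumes N: "N \<ge> 1" and root: "poly (map_poly of_real (p_poly 2 N a \<mu>)) z = 0" and z: "norm z \<ge> 1"
  obtains w where "Re w \<ge> 0" "norm w \<le> 1"
    "of_real \<mu> * (w * (\<Sum>j = 1..N. of_real (a j) * (w\<^sup>2) ^ (j - 1)))\<^sup>2 = 1"
proof
  define w where "w = csqrt (1 / z)"
  show "Re w \<ge> 0"
    unfolding w_def by (rule Re_csqrt)
  have "z \<noteq> 0"
    using z by auto
  have w2: "w\<^sup>2 = 1 / z"
    by (simp add: w_def)
  then have "(norm w)\<^sup>2 = 1 / norm z"
    by (metis norm_divide norm_one norm_power)
  also have "\<dots> \<le> 1\<^sup>2"
    using z by (simp add: divide_le_eq)
  finally show "norm w \<le> 1"
    by (rule power2_le_imp_le) simp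
  let ?A = "\<Sum>j = 1..N. of_real (a j) * (w\<^sup>2) ^ (j - 1)"
  have "(\<Sum>j = 1..N. of_real (a j) * z ^ (N - j)) = z ^ (N - 1) * ?A"
    unfolding sum_distrib_left
  proof (rule sum.cong)
    fix j assume "j \<in> {1..N}"
    then have "z ^ (N - 1) = z ^ (N - j) * z ^ (j - 1)"
      by (simp flip: power_add)
    then show "of_real (a j) * z ^ (N - j) = z ^ (N - 1) * (of_real (a j) * (w\<^sup>2) ^ (j - 1))"
      using \<open>z \<noteq> 0\<close> by (simp add: w2 power_divide)
  qed simp
  then have "z ^ ((N - 1) * 2 + 1) = of_real \<mu> * (z ^ (N - 1) * ?A)\<^sup>2"
    using root by (simp add: poly_of_real_p_poly_2)
  then have "(z ^ (N - 1))\<^sup>2 * z = (z ^ (N - 1))\<^sup>2 * (of_real \<mu> * ?A\<^sup>2)"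
    by (simp only: power_add power_mult power_one_right power_mult_distrib mult.left_commute)
  then have "z = of_real \<mu> * ?A\<^sup>2"
    using \<open>z \<noteq> 0\<close> by simp
  moreover have "z * w\<^sup>2 = 1"
    using \<open>z \<noteq> 0\<close> by (simp add: w2)
  ultimately have "of_real \<mu> * ?A\<^sup>2 * w\<^sup>2 = 1"
    by (simp only:)
  then show "of_real \<mu> * (w * ?A)\<^sup>2 = 1"
    by (simp add: power_mult_distrib mult_ac)
qed

theorem theorem3:
  fixes N T :: nat and \<mu>' :: real
  assumes "T = 2" and "N \<ge> 1" and "\<mu>' \<in> {- (real N)\<^sup>2 <..< 1}"
  shows "\<exists>a :: nat \<Rightarrow> real. (\<Sum>j = 1..N. a j) = 1 \<and>
    (\<forall>\<mu> \<in> {\<mu>' <..< 1}. \<forall>z :: complex.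
       poly (map_poly of_real (p_poly T N a \<mu>)) z = 0 \<longrightarrow> norm z < 1)"
proof -
  obtain \<epsilon> where \<epsilon>: "\<epsilon> > 0" "\<epsilon> \<le> 1" "- \<mu>' * ((1 - \<epsilon>) / real N + \<epsilon>)\<^sup>2 < 1"
    using exists_damping [of N \<mu>'] assms by auto
  have "norm z < 1"
    if \<mu>: "\<mu> \<in> {\<mu>' <..< 1}"
      and root: "poly (map_poly of_real (p_poly T N (damped_coeff N \<epsilon>) \<mu>)) z = 0"
    for \<mu> and z :: complex
  proof (rule ccontr)
    assume "\<not> norm z < 1"
    then have "norm z \<ge> 1" by simp
    from root_p_poly_2_half_disc [OF \<open>N \<ge> 1\<close> root [unfolded \<open>T = 2\<close>] this]
    obtain w where w: "Re w \<ge> 0" "norm w \<le> 1" and "of_real \<mu> * (damped_odd N \<epsilon> w)\<^sup>2 = 1"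
      unfolding damped_odd_eq_sum [OF \<open>N \<ge> 1\<close>] .
    moreover have "- \<mu> * ((1 - \<epsilon>) / real N + \<epsilon>)\<^sup>2 \<le> - \<mu>' * ((1 - \<epsilon>) / real N + \<epsilon>)\<^sup>2"
      using \<mu> by (intro mult_right_mono) auto
    ultimately show False
      using damped_odd_excludes [of N \<epsilon> \<mu> w] \<epsilon> \<mu> \<open>N \<ge> 1\<close> by auto
  qed
  then show ?thesis
    using sum_damped_coeff [OF \<open>N \<ge> 1\<close>] by (intro exI [of _ "damped_coeff N \<epsilon>"]) auto
qed

end
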